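(* Let $C$ be the Cesàro operator on the Hardy space $H^2$. For $A\in\mathcal{B}(H^2)$ the following are equivalent. (i) $A^2=C$. (ii) With respect to the orthonormal basis $(z^n)_{n=0}^\infty$ of $H^2$, the matrix representation of $A$ is either $[A_{ij}]_{i,j=0}^\infty$ or $-[A_{ij}]_{i,j=0}^\infty$, where $$A_{ij}=\begin{cases}\displaystyle\binom{i}{j}\sum_{\ell=0}^{i-j}(-1)^\ell\frac{1}{\sqrt{\ell+j+1}}\binom{i-j}{\ell}, & i\ge j,\\ 0,& i<j.\end{cases}$$
   Context: $H^2$ is the Hardy space of the open unit disc $\mathbb{D}$ and $\mathcal{B}(H^2)$ the bounded linear operators on it. The Cesàro operator $C:H^2\to H^2$ is the bounded operator $(Cf)(z)=\frac1z\int_0^z\frac{f(\xi)}{1-\xi}\,d\xi$; equivalently, if $f(z)=\sum_{j\ge0}a_jz^j$, then $(Cf)(z)=\sum_{n=0}^\infty\left(\frac1{n+1}\sum_{j=0}^na_j\right)z^n$. The matrix representation of $A$ has $(i,j)$ entry $\langle Az^j,z^i\rangle_{H^2}$; thus that of $C$ is the lower triangular matrix with $(i,j)$ entry $\frac1{i+1}$ for $j\le i$ and $0$ otherwise. *)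

theory Defs
  imports "HOL-Complex_Analysis.Complex_Analysis"
begin

definition taylor_coeff :: "(complex \<Rightarrow> complex) \<Rightarrow> nat \<Rightarrow> complex" where
  "taylor_coeff f n = (deriv ^^ n) f 0 / fact n"

text \<open>
  The Hardy space of the open unit disc: holomorphic functions on the disc with
  square-summable Taylor coefficients. Since functions are total in HOL, an element is
  represented by its extension by zero, so that equality of elements is equality on the disc
  and the pointwise vector space operations stay inside the space.
\<close>

definition hardy_space :: "(complex \<Rightarrow> complex) set" where
  "hardy_space = {f. f holomorphic_on ball 0 1 \<and> (\<forall>z. z \<notin> ball 0 1 \<longrightarrow> f z = 0) \<and>
     summable (\<lambda>n. (norm (taylor_coeff f n))\<^sup>2)}"

definition hardy_inner :: "(complex \<Rightarrow> complex) \<Rightarrow> (complex \<Rightarrow> complex) \<Rightarrow> complex" where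
  "hardy_inner f g = (\<Sum>n. taylor_coeff f n * cnj (taylor_coeff g n))"

definition hardy_norm :: "(complex \<Rightarrow> complex) \<Rightarrow> real" where
  "hardy_norm f = sqrt (Re (hardy_inner f f))"

definition hardy_monom :: "nat \<Rightarrow> complex \<Rightarrow> complex" where
  "hardy_monom n z = (if z \<in> ball 0 1 then z ^ n else 0)"

text \<open>
  Bounded complex-linear operators on the Hardy space. Nothing is required of the values
  outside \<^const>\<open>hardy_space\<close>, so operators are to be compared on that set only.
\<close>

definition hardy_bounded_operator ::
    "((complex \<Rightarrow> complex) \<Rightarrow> complex \<Rightarrow> complex) \<Rightarrow> bool" where
  "hardy_bounded_operator A \<longleftrightarrow>
     (\<forall>f\<in>hardy_space. A f \<in> hardy_space) \<and>
     (\<forall>f\<in>hardy_space. \<forall>g\<in>hardy_space. A (\<lambda>z. f z + g z) = (\<lambda>z. A f z + A g z)) \<and>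
     (\<forall>c. \<forall>f\<in>hardy_space. A (\<lambda>z. c * f z) = (\<lambda>z. c * A f z)) \<and>
     (\<exists>K. \<forall>f\<in>hardy_space. hardy_norm (A f) \<le> K * hardy_norm f)"

definition hardy_matrix ::
    "((complex \<Rightarrow> complex) \<Rightarrow> complex \<Rightarrow> complex) \<Rightarrow> nat \<Rightarrow> nat \<Rightarrow> complex" where
  "hardy_matrix A i j = hardy_inner (A (hardy_monom j)) (hardy_monom i)"

text \<open>
  The singularity of the averaging formula at the origin is removable; its limit there
  is \<open>f 0\<close>.
\<close>

definition cesaro :: "(complex \<Rightarrow> complex) \<Rightarrow> complex \<Rightarrow> complex" where
  "cesaro f z =
     (if z \<notin> ball 0 1 then 0
      else if z = 0 then f 0
      else 1 / z * contour_integral (linepath 0 z) (\<lambda>w. f w / (1 - w)))"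

definition cesaro_sqrt_entry :: "nat \<Rightarrow> nat \<Rightarrow> real" where
  "cesaro_sqrt_entry i j =
     (if j \<le> i
      then real (i choose j) *
           (\<Sum>l=0..i - j. (-1) ^ l * (1 / sqrt (real (l + j + 1))) * real ((i - j) choose l))
      else 0)"

end

theory Submission
  imports Defs
begin

text \<open>
  For real \<open>\<mu> \<ge> 1\<close>, pairing with the coefficients of \<open>(1 - z)\<^sup>\<mu>\<^sup>-\<^sup>1\<close> is a bounded
  functional \<open>L\<^sub>\<mu>\<close> with \<open>L\<^sub>\<mu> (C f) = L\<^sub>\<mu> f / \<mu>\<close>, and such eigenfunctionals of \<open>C\<close> are unique up to
  scalars. If \<open>A\<^sup>2 = C\<close>, then \<open>A\<close> commutes with \<open>C\<close>, so \<open>L\<^sub>\<mu> (A f) = \<phi> \<mu> * L\<^sub>\<mu> f\<close> with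
  \<open>(\<phi> \<mu>)\<^sup>2 = 1 / \<mu>\<close>. As \<open>\<phi>\<close> is continuous on \<open>[1, \<infinity>)\<close>, one sign serves all \<open>\<mu>\<close>: this is what
  rules out the infinitely many other formal triangular square roots. At \<open>\<mu> = n + 1\<close> the
  functional involves only the signed binomial coefficients \<open>(-1)\<^sup>k (n choose k)\<close>, and binomial
  inversion turns these identities into the matrix entries of \<open>A\<close>. Conversely, a matrix of the
  given form makes \<open>A\<^sup>2\<close> and \<open>C\<close> agree under all functionals \<open>L\<^sub>n\<^sub>+\<^sub>1\<close>, which separate points.
\<close>

subsection \<open>The Hardy space in terms of Taylor coefficients\<close>

lemma taylor_coeff_sums:
  assumes "f holomorphic_on ball 0 1" "z \<in> ball 0 1"
  shows "(\<lambda>n. taylor_coeff f n * z ^ n) sums f z"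
  using holomorphic_power_series[OF assms] by (simp add: taylor_coeff_def)

text \<open>By uniqueness of formal power series expansions at 0. Every coefficient computation
  below goes through this rule, so no derivative of a concrete function has to be evaluated.\<close>

lemma taylor_coeff_eqI:
  assumes "\<And>z. z \<in> ball 0 1 \<Longrightarrow> (\<lambda>n. c n * z ^ n) sums f z"
  shows "taylor_coeff f = c"
proof -
  \<comment> \<open>Convergence at any single nonzero point of the disc forces a positive radius of
    convergence.\<close>
  have "summable (\<lambda>n. c n * (1/2) ^ n)"
    using assms[of "1/2"] by (simp add: sums_iff)
  then have "conv_radius c \<ge> norm (1/2::complex)"
    by (rule conv_radius_geI)
  then have rad: "fps_conv_radius (Abs_fps c) > 0"
    by (simp add: fps_conv_radius_def) (meson ereal_less(2) less_le_trans half_gt_zero zero_less_one)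
  have "eventually (\<lambda>z. z \<in> ball 0 1) (nhds (0::complex))"
    by (rule eventually_nhds_in_open) auto
  then have "eventually (\<lambda>z. eval_fps (Abs_fps c) z = f z) (nhds 0)"
    by eventually_elim (use assms in \<open>auto simp: eval_fps_def sums_iff\<close>)
  with rad have "f has_fps_expansion Abs_fps c"
    by (simp add: has_fps_expansion_def)
  then have "fps_expansion f 0 = Abs_fps c"
    by (rule fps_expansion_eqI)
  then show ?thesis
    unfolding fps_expansion_def taylor_coeff_def by (simp add: fps_eq_iff fun_eq_iff)
qed

lemma hardy_spaceD:
  assumes "f \<in> hardy_space"
  shows "f holomorphic_on ball 0 1" "z \<notin> ball 0 1 \<Longrightarrow> f z = 0"
    "summable (\<lambda>n. (norm (taylor_coeff f n))\<^sup>2)"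
  using assms by (auto simp: hardy_space_def)

text \<open>Only \<open>f\<close> is taken from the Hardy space, so the rule applies with
  \<open>g\<close> equal to \<open>cesaro f\<close>, which is known through its power series
  alone.\<close>

lemma hardy_space_eqI:
  assumes f: "f \<in> hardy_space" and g: "\<And>z. z \<notin> ball 0 1 \<Longrightarrow> g z = 0"
    and sums: "\<And>z. z \<in> ball 0 1 \<Longrightarrow> (\<lambda>n. taylor_coeff f n * z ^ n) sums g z"
  shows "f = g"
proof
  fix z show "f z = g z"
    using hardy_spaceD(2)[OF f, of z] g[of z] sums[of z]
      taylor_coeff_sums[OF hardy_spaceD(1)[OF f], of z]
    by (cases "z \<in> ball 0 1") (auto dest: sums_unique2)
qed

lemma hardy_space_coeff_eqI:
  assumes "f \<in> hardy_space" "g \<in> hardy_space" "taylor_coeff f = taylor_coeff g"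
  shows "f = g"
  using assms taylor_coeff_sums[OF hardy_spaceD(1)[OF assms(2)]]
  by (intro hardy_space_eqI) (auto dest: hardy_spaceD(2))

section \<open>Linear structure of the Hardy space\<close>

lemma taylor_coeff_add:
  assumes "f \<in> hardy_space" "g \<in> hardy_space"
  shows "taylor_coeff (\<lambda>z. f z + g z) n = taylor_coeff f n + taylor_coeff g n"
  unfolding taylor_coeff_def
  using higher_deriv_add[OF hardy_spaceD(1)[OF assms(1)] hardy_spaceD(1)[OF assms(2)], of 0 n]
  by (simp add: add_divide_distrib)

lemma taylor_coeff_cmult:
  assumes "f \<in> hardy_space"
  shows "taylor_coeff (\<lambda>z. c * f z) n = c * taylor_coeff f n"
  unfolding taylor_coeff_def
  using higher_deriv_cmult[OF hardy_spaceD(1)[OF assms], of 0 n c] by simp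

lemma norm_add_power2_le: "(norm (x + y))\<^sup>2 \<le> 2 * (norm x)\<^sup>2 + 2 * (norm y)\<^sup>2"
  for x y :: "'a::real_normed_vector"
proof -
  have "(norm (x + y))\<^sup>2 \<le> (norm x + norm y)\<^sup>2"
    by (intro power_mono norm_triangle_ineq) auto
  also have "\<dots> \<le> 2 * (norm x)\<^sup>2 + 2 * (norm y)\<^sup>2"
    using zero_le_power2[of "norm x - norm y"] by (simp add: power2_eq_square algebra_simps)
  finally show ?thesis .
qed

lemma hardy_space_add:
  assumes "f \<in> hardy_space" "g \<in> hardy_space"
  shows "(\<lambda>z. f z + g z) \<in> hardy_space"
proof -
  have "summable (\<lambda>n. (norm (taylor_coeff (\<lambda>z. f z + g z) n))\<^sup>2)"
  proof (rule summable_comparison_test'[where N = 0])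
    show "summable (\<lambda>n. 2 * (norm (taylor_coeff f n))\<^sup>2 + 2 * (norm (taylor_coeff g n))\<^sup>2)"
      using assms by (intro summable_add summable_mult hardy_spaceD)
  qed (auto simp: taylor_coeff_add[OF assms] norm_add_power2_le)
  then show ?thesis
    using assms by (auto simp: hardy_space_def intro!: holomorphic_intros)
qed

lemma hardy_space_cmult:
  assumes "f \<in> hardy_space"
  shows "(\<lambda>z. c * f z) \<in> hardy_space"
proof -
  have "summable (\<lambda>n. (norm (taylor_coeff (\<lambda>z. c * f z) n))\<^sup>2)"
    using summable_mult[OF hardy_spaceD(3)[OF assms], of "(norm c)\<^sup>2"]
    by (simp add: taylor_coeff_cmult[OF assms] norm_mult power_mult_distrib)
  then show ?thesis
    using assms by (auto simp: hardy_space_def intro!: holomorphic_intros)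
qed

section \<open>Monomials, norm and matrix entries\<close>

lemma taylor_coeff_hardy_monom: "taylor_coeff (hardy_monom n) = (\<lambda>k. if k = n then 1 else 0)"
proof (rule taylor_coeff_eqI)
  fix z :: complex assume "z \<in> ball 0 1"
  then show "(\<lambda>k. (if k = n then 1 else 0) * z ^ k) sums hardy_monom n z"
    using sums_single[of n "\<lambda>k. z ^ k"]
    by (simp add: hardy_monom_def if_distrib[of "\<lambda>x. x * _"] cong: if_cong)
qed

lemma hardy_monom_in_hardy_space: "hardy_monom n \<in> hardy_space"
proof -
  have "(\<lambda>z. z ^ n) holomorphic_on ball 0 1"
    by (intro holomorphic_intros)
  then have "hardy_monom n holomorphic_on ball 0 1"
    by (rule holomorphic_transform) (simp add: hardy_monom_def)
  moreover have "summable (\<lambda>k. (norm (taylor_coeff (hardy_monom n) k))\<^sup>2)"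
    by (rule summable_finite[of "{n}"]) (auto simp: taylor_coeff_hardy_monom)
  ultimately show ?thesis
    by (auto simp: hardy_space_def hardy_monom_def)
qed

lemma hardy_norm_eq:
  assumes "f \<in> hardy_space"
  shows "hardy_norm f = sqrt (\<Sum>n. (norm (taylor_coeff f n))\<^sup>2)"
proof -
  have "hardy_inner f f = (\<Sum>n. complex_of_real ((norm (taylor_coeff f n))\<^sup>2))"
    unfolding hardy_inner_def by (simp add: complex_norm_square del: of_real_power)
  also have "\<dots> = complex_of_real (\<Sum>n. (norm (taylor_coeff f n))\<^sup>2)"
    using hardy_spaceD(3)[OF assms] by (rule suminf_of_real[symmetric])
  finally show ?thesis by (simp add: hardy_norm_def)
qed

lemma hardy_matrix_eq: "hardy_matrix A i j = taylor_coeff (A (hardy_monom j)) i"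
proof -
  have "(\<lambda>n. taylor_coeff (A (hardy_monom j)) n * cnj (taylor_coeff (hardy_monom i) n))
    sums (taylor_coeff (A (hardy_monom j)) i)"
    using sums_single[of i "\<lambda>k. taylor_coeff (A (hardy_monom j)) k"]
    by (simp add: taylor_coeff_hardy_monom if_distrib cong: if_cong)
  then show ?thesis
    by (simp add: hardy_matrix_def hardy_inner_def sums_iff)
qed

section \<open>Pairings with square-summable sequences\<close>

lemma summable_mult_of_square_summable:
  fixes w g :: "nat \<Rightarrow> complex"
  assumes "summable (\<lambda>n. (norm (w n))\<^sup>2)" "summable (\<lambda>n. (norm (g n))\<^sup>2)"
  shows "summable (\<lambda>n. w n * g n)"
proof (rule summable_comparison_test'[where N = 0])
  show "summable (\<lambda>n. (norm (w n))\<^sup>2 + (norm (g n))\<^sup>2)"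
    by (intro summable_add assms)
  fix n
  have "2 * (norm (w n) * norm (g n)) \<le> (norm (w n))\<^sup>2 + (norm (g n))\<^sup>2"
    using zero_le_power2[of "norm (w n) - norm (g n)"] by (simp add: power2_eq_square algebra_simps)
  moreover have "0 \<le> norm (w n) * norm (g n)" by simp
  ultimately show "norm (w n * g n) \<le> (norm (w n))\<^sup>2 + (norm (g n))\<^sup>2"
    unfolding norm_mult by linarith
qed

text \<open>Cauchy-Schwarz for the bilinear pairing (no conjugation), obtained from the finite
  inequality by passing to the limit of the partial sums.\<close>

lemma norm_suminf_mult_le:
  fixes w g :: "nat \<Rightarrow> complex"
  assumes w: "summable (\<lambda>n. (norm (w n))\<^sup>2)" and g: "summable (\<lambda>n. (norm (g n))\<^sup>2)"
  shows "norm (\<Sum>n. w n * g n) \<le> sqrt (\<Sum>n. (norm (w n))\<^sup>2) * sqrt (\<Sum>n. (norm (g n))\<^sup>2)"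
proof (rule Lim_bounded)
  show "(\<lambda>N. norm (\<Sum>n<N. w n * g n)) \<longlonglongrightarrow> norm (\<Sum>n. w n * g n)"
    by (intro tendsto_norm summable_LIMSEQ summable_mult_of_square_summable w g)
  show "\<forall>N\<ge>0. norm (\<Sum>n<N. w n * g n)
      \<le> sqrt (\<Sum>n. (norm (w n))\<^sup>2) * sqrt (\<Sum>n. (norm (g n))\<^sup>2)"
  proof safe
    fix N
    have "norm (\<Sum>n<N. w n * g n) \<le> (\<Sum>n<N. \<bar>norm (w n)\<bar> * \<bar>norm (g n)\<bar>)"
      by (rule order_trans[OF norm_sum]) (simp add: norm_mult)
    also have "\<dots> \<le> L2_set (\<lambda>n. norm (w n)) {..<N} * L2_set (\<lambda>n. norm (g n)) {..<N}"
      by (rule L2_set_mult_ineq)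
    also have "\<dots> \<le> sqrt (\<Sum>n. (norm (w n))\<^sup>2) * sqrt (\<Sum>n. (norm (g n))\<^sup>2)"
      unfolding L2_set_def
      by (intro mult_mono real_sqrt_le_mono sum_le_suminf w g) (auto intro: sum_nonneg suminf_nonneg w g)
    finally show "norm (\<Sum>n<N. w n * g n)
      \<le> sqrt (\<Sum>n. (norm (w n))\<^sup>2) * sqrt (\<Sum>n. (norm (g n))\<^sup>2)" .
  qed
qed

lemma hardy_bounded_operatorD:
  assumes "hardy_bounded_operator A" "f \<in> hardy_space"
  shows "A f \<in> hardy_space"
    "g \<in> hardy_space \<Longrightarrow> A (\<lambda>z. f z + g z) = (\<lambda>z. A f z + A g z)"
    "A (\<lambda>z. c * f z) = (\<lambda>z. c * A f z)"
  using assms by (auto simp: hardy_bounded_operator_def)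

lemma suminf_power2_tail_tendsto_0:
  fixes a :: "nat \<Rightarrow> complex"
  assumes "summable (\<lambda>n. (norm (a n))\<^sup>2)"
  shows "(\<lambda>N. \<Sum>n. (norm (if n < N then 0 else a n))\<^sup>2) \<longlonglongrightarrow> 0"
proof -
  have "(\<Sum>n. (norm (if n < N then 0 else a n))\<^sup>2) = (\<Sum>n. (norm (a (n + N)))\<^sup>2)" for N
  proof -
    have "summable (\<lambda>n. (norm (if n < N then 0 else a n))\<^sup>2)"
      by (rule summable_comparison_test'[OF assms, where N = 0]) auto
    from suminf_split_initial_segment[OF this, of N] show ?thesis by simp
  qed
  moreover have "(\<lambda>N. \<Sum>n. (norm (a (n + N)))\<^sup>2) \<longlonglongrightarrow> 0"
    using suminf_exist_split2[OF assms] by simp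
  ultimately show ?thesis by simp
qed

text \<open>Truncations of \<open>f\<close> converge to \<open>f\<close> in norm; boundedness of
  \<open>A\<close> and Cauchy-Schwarz carry this over to the functional. Identities checked on
  monomials thereby extend to the whole space.\<close>

lemma hardy_functional_sums:
  assumes A: "hardy_bounded_operator A" and w: "summable (\<lambda>n. (norm (w n))\<^sup>2)"
    and f: "f \<in> hardy_space"
  shows "(\<lambda>j. taylor_coeff f j * (\<Sum>k. w k * taylor_coeff (A (hardy_monom j)) k))
    sums (\<Sum>k. w k * taylor_coeff (A f) k)"
proof -
  define T where "T g = (\<Sum>k. w k * taylor_coeff (A g) k)" for g
  define W where "W = sqrt (\<Sum>n. (norm (w n))\<^sup>2)"
  define trunc where "trunc N = (\<lambda>z. \<Sum>j<N. taylor_coeff f j * hardy_monom j z)" for N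
  note [simp] = hardy_bounded_operatorD[OF A] hardy_spaceD(3) hardy_monom_in_hardy_space
    hardy_space_add hardy_space_cmult
  have [simp]: "summable (\<lambda>k. w k * taylor_coeff (A g) k)" if "g \<in> hardy_space" for g
    using that by (intro summable_mult_of_square_summable w) simp
  have T_add: "T (\<lambda>z. g z + h z) = T g + T h" if "g \<in> hardy_space" "h \<in> hardy_space" for g h
    using that by (simp add: T_def taylor_coeff_add distrib_left suminf_add)
  have T_cmult: "T (\<lambda>z. c * g z) = c * T g" if "g \<in> hardy_space" for c g
    using that by (simp add: T_def taylor_coeff_cmult mult.left_commute[of _ c] suminf_mult)
  have zero: "(\<lambda>z. 0) \<in> hardy_space"
    using hardy_space_cmult[OF f, of 0] by simp
  \<comment> \<open>The three facts are proved together because additivity of \<open>T\<close> and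
    of the coefficients is available only for members of the space.\<close>
  have trunc_in: "trunc N \<in> hardy_space \<and> taylor_coeff (trunc N) =
      (\<lambda>n. if n < N then taylor_coeff f n else 0) \<and>
      T (trunc N) = (\<Sum>j<N. taylor_coeff f j * T (hardy_monom j))" for N
  proof (induction N)
    case 0
    show ?case
      using zero T_cmult[OF f, of 0] taylor_coeff_cmult[OF f, of 0]
      by (simp add: trunc_def fun_eq_iff)
  next
    case (Suc N)
    have "trunc (Suc N) = (\<lambda>z. trunc N z + taylor_coeff f N * hardy_monom N z)"
      by (simp add: trunc_def)
    with Suc show ?case
      by (auto simp: taylor_coeff_add taylor_coeff_cmult taylor_coeff_hardy_monom T_add T_cmult
          fun_eq_iff less_Suc_eq)
  qed
  obtain K where K: "\<And>g. g \<in> hardy_space \<Longrightarrow> hardy_norm (A g) \<le> K * hardy_norm g"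
    using A by (auto simp: hardy_bounded_operator_def)
  have T_le: "norm (T g) \<le> W * (K * hardy_norm g)" if g: "g \<in> hardy_space" for g
  proof -
    have "norm (T g) \<le> W * hardy_norm (A g)"
      using norm_suminf_mult_le[OF w, of "taylor_coeff (A g)"] g
      by (simp add: T_def W_def hardy_norm_eq)
    also have "\<dots> \<le> W * (K * hardy_norm g)"
      by (intro mult_left_mono K g) (simp add: W_def suminf_nonneg w)
    finally show ?thesis .
  qed
  \<comment> \<open>The remainder is written with \<open>(-1) *\<close> so that closure under sums
    and scalar multiples suffices.\<close>
  define rest where "rest N = (\<lambda>z. f z + (-1) * trunc N z)" for N
  have rest_in: "rest N \<in> hardy_space" for N
    using hardy_space_add[OF f hardy_space_cmult[of "trunc N" "-1"]] trunc_in[of N]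
    by (simp only: rest_def)
  have rest_coeff: "taylor_coeff (rest N) n = (if n < N then 0 else taylor_coeff f n)" for N n
    unfolding rest_def
    using trunc_in[of N] taylor_coeff_add[OF f hardy_space_cmult[of "trunc N" "-1"], of n]
      taylor_coeff_cmult[of "trunc N" "-1" n] by auto
  have T_rest: "T (rest N) = T f - T (trunc N)" for N
    unfolding rest_def
    using trunc_in[of N] T_add[OF f hardy_space_cmult[of "trunc N" "-1"]]
      T_cmult[of "trunc N" "-1"] by simp
  have "(\<lambda>N. hardy_norm (rest N)) \<longlonglongrightarrow> sqrt 0"
    unfolding hardy_norm_eq[OF rest_in] rest_coeff
    by (intro tendsto_real_sqrt suminf_power2_tail_tendsto_0 hardy_spaceD(3) f)
  then have lim: "(\<lambda>N. W * (K * hardy_norm (rest N))) \<longlonglongrightarrow> 0"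
    using tendsto_mult_left[of "\<lambda>N. hardy_norm (rest N)" 0 sequentially "W * K"]
    by (simp add: mult.assoc)
  have "(\<lambda>N. T (rest N)) \<longlonglongrightarrow> 0"
    by (rule Lim_null_comparison[OF _ lim]) (simp add: T_le rest_in)
  then have "(\<lambda>N. T f - T (rest N)) \<longlonglongrightarrow> T f - 0"
    by (intro tendsto_intros)
  then have "(\<lambda>j. taylor_coeff f j * T (hardy_monom j)) sums T f"
    using trunc_in by (simp add: T_rest sums_def)
  then show ?thesis by (simp add: T_def)
qed

subsection \<open>The Cesaro operator on Taylor coefficients\<close>

text \<open>Multiplying by the geometric series turns the coefficients of \<open>f\<close> into
  their partial sums; a primitive on the disc divides the n-th of these by n + 1 and shifts the
  index, and division by z shifts it back.\<close>

lemma cesaro_sums: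
  assumes f: "f holomorphic_on ball 0 1" and z: "z \<in> ball 0 1"
  shows "(\<lambda>n. (\<Sum>j\<le>n. taylor_coeff f j) / of_nat (Suc n) * z ^ n) sums cesaro f z"
proof -
  define g where "g = (\<lambda>w. f w / (1 - w))"
  have g: "g holomorphic_on ball 0 1"
    unfolding g_def using f by (auto intro!: holomorphic_intros)
  have "(\<lambda>n. (\<Sum>j\<le>n. taylor_coeff f j) * w ^ n) sums g w" if w: "w \<in> ball 0 1" for w
  proof -
    \<comment> \<open>The Cauchy product needs absolute convergence at \<open>w\<close>, which
      follows from convergence at a point of larger modulus r.\<close>
    obtain r where r: "norm w < r" "r < 1" using w dense[of "norm w" 1] by auto
    then have "summable (\<lambda>n. taylor_coeff f n * complex_of_real r ^ n)"
      using taylor_coeff_sums[OF f, of "of_real r"] r norm_ge_zero[of w]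
      by (auto simp: sums_iff simp del: norm_ge_zero)
    then have "summable (\<lambda>n. norm (taylor_coeff f n * w ^ n))"
      by (rule powser_insidea) (use r in auto)
    moreover have "summable (\<lambda>n. norm (w ^ n))"
      using w by (simp add: norm_power summable_geometric)
    ultimately have "(\<lambda>n. \<Sum>j\<le>n. (taylor_coeff f j * w ^ j) * w ^ (n - j)) sums
        ((\<Sum>n. taylor_coeff f n * w ^ n) * (\<Sum>n. w ^ n))"
      by (rule Cauchy_product_sums)
    moreover have "(\<Sum>j\<le>n. (taylor_coeff f j * w ^ j) * w ^ (n - j)) = (\<Sum>j\<le>n. taylor_coeff f j) * w ^ n" for n
      by (simp add: sum_distrib_right mult.assoc flip: power_add)
    ultimately show ?thesis
      using taylor_coeff_sums[OF f w] geometric_sums[of w] w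
      by (simp add: sums_iff g_def)
  qed
  then have coeff_g: "taylor_coeff g = (\<lambda>n. \<Sum>j\<le>n. taylor_coeff f j)"
    by (rule taylor_coeff_eqI)
  obtain G where G: "\<And>w. w \<in> ball 0 1 \<Longrightarrow> (G has_field_derivative g w) (at w within ball 0 1)"
    using holomorphic_convex_primitive'[OF convex_ball open_ball g] by blast
  then have G': "(G has_field_derivative g w) (at w)" if "w \<in> ball 0 1" for w
    using that at_within_open[OF that open_ball] by metis
  have hol_G: "G holomorphic_on ball 0 1"
    unfolding holomorphic_on_open[OF open_ball] using G' by blast
  have coeff_G: "taylor_coeff G (Suc n) = (\<Sum>j\<le>n. taylor_coeff f j) / of_nat (Suc n)" for n
  proof -
    have "(deriv ^^ n) (deriv G) 0 = (deriv ^^ n) g 0"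
      by (rule higher_deriv_transform_within_open[of _ "ball 0 1"])
        (use g hol_G G' in \<open>auto intro!: holomorphic_deriv DERIV_imp_deriv\<close>)
    then have "taylor_coeff G (Suc n) = taylor_coeff g n / of_nat (Suc n)"
      by (simp add: taylor_coeff_def funpow_Suc_right del: funpow.simps)
    then show ?thesis by (simp add: coeff_g)
  qed
  show ?thesis
  proof (cases "z = 0")
    case True
    then show ?thesis
      using sums_single[of 0 "\<lambda>n. (\<Sum>j\<le>n. taylor_coeff f j) / of_nat (Suc n)"]
      by (simp add: cesaro_def taylor_coeff_def power_0_left if_distrib cong: if_cong)
  next
    case False
    have "(g has_contour_integral (G (pathfinish (linepath 0 z)) - G (pathstart (linepath 0 z)))) (linepath 0 z)"
      by (rule contour_integral_primitive[OF G])
        (use z in \<open>auto simp: dist_norm closed_segment_subset intro!: subsetD[OF closed_segment_subset[OF _ _ convex_ball]]\<close>)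
    then have "contour_integral (linepath 0 z) g = G z - G 0"
      by (simp add: contour_integral_unique)
    then have ces: "cesaro f z = (G z - G 0) / z"
      using z False by (simp add: cesaro_def g_def)
    have "(\<lambda>n. taylor_coeff G (Suc n) * z ^ Suc n) sums (G z - taylor_coeff G 0 * z ^ 0)"
      using taylor_coeff_sums[OF hol_G z] by (subst sums_Suc_iff) simp
    then have "(\<lambda>n. taylor_coeff G (Suc n) * z ^ Suc n / z) sums ((G z - G 0) / z)"
      by (intro sums_divide) (simp add: taylor_coeff_def)
    then show ?thesis
      using False by (simp add: coeff_G ces)
  qed
qed

subsection \<open>Eigenfunctionals of the Cesaro operator\<close>

text \<open>The coefficients of \<open>(1 - z)\<^sup>\<mu>\<^sup>-\<^sup>1\<close>.\<close>

definition cesaro_eigvec :: "real \<Rightarrow> nat \<Rightarrow> real" where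
  "cesaro_eigvec \<mu> j = (-1) ^ j * ((\<mu> - 1) gchoose j)"

lemma cesaro_eigvec_0 [simp]: "cesaro_eigvec \<mu> 0 = 1"
  by (simp add: cesaro_eigvec_def)

text \<open>The recursion behind the eigenvector property: subtracting consecutive instances of
  sum_{i \<ge> j} w_i / (i + 1) = w_j / \<mu>, the eigenvector equation of the transposed Cesaro
  matrix, gives exactly this relation.\<close>

lemma cesaro_eigvec_Suc:
  "cesaro_eigvec \<mu> (Suc j) = (1 - \<mu> / real (Suc j)) * cesaro_eigvec \<mu> j"
proof -
  have "real (Suc j) * ((\<mu> - 1) gchoose Suc j) = (\<mu> - 1 - real j) * ((\<mu> - 1) gchoose j)"
    using gbinomial_mult_1[of "\<mu> - 1" j] by (simp add: algebra_simps)
  then have eq: "(\<mu> - 1) gchoose Suc j = (\<mu> - 1 - real j) * ((\<mu> - 1) gchoose j) / real (Suc j)"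
    by (simp add: field_simps del: of_nat_Suc)
  then show ?thesis
    unfolding cesaro_eigvec_def eq by (simp add: field_simps)
qed

lemma cesaro_eigvec_of_nat:
  "cesaro_eigvec (real (Suc n)) j = (-1) ^ j * real (n choose j)"
  by (simp add: cesaro_eigvec_def binomial_gbinomial)

lemma continuous_on_cesaro_eigvec: "continuous_on S (\<lambda>\<mu>. cesaro_eigvec \<mu> j)"
  by (induction j) (auto simp: cesaro_eigvec_Suc intro!: continuous_intros)

text \<open>The weight \<open>j + 1\<close> makes the left-hand side nonincreasing in \<open>j\<close> from \<open>j = m\<close> on.\<close>

lemma cesaro_eigvec_bound:
  assumes "1 \<le> \<mu>" "\<mu> \<le> real m"
  shows "real (Suc j) * \<bar>cesaro_eigvec \<mu> j\<bar> \<le> real (Suc m) ^ Suc m"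
proof -
  \<comment> \<open>A crude bound for the indices up to m: each factor of the recursion has modulus
    at most m + 1.\<close>
  have small: "\<bar>cesaro_eigvec \<mu> j\<bar> \<le> real (Suc m) ^ j" for j
  proof (induction j)
    case (Suc j)
    have "\<mu> / real (Suc j) \<le> \<mu>"
      using assms by (simp add: field_simps)
    moreover have "0 \<le> \<mu> / real (Suc j)"
      using assms by simp
    ultimately have "\<bar>1 - \<mu> / real (Suc j)\<bar> \<le> real (Suc m)"
      using assms by linarith
    then show ?case
      using Suc by (simp add: cesaro_eigvec_Suc abs_mult mult_mono del: of_nat_Suc)
  qed simp
  show ?thesis
  proof (cases "j \<le> m")
    case True
    have "real (Suc j) * \<bar>cesaro_eigvec \<mu> j\<bar> \<le> real (Suc m) * real (Suc m) ^ j"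
      using True by (intro mult_mono small) auto
    also have "\<dots> \<le> real (Suc m) * real (Suc m) ^ m"
      using True by (intro mult_left_mono power_increasing) auto
    finally show ?thesis by simp
  next
    case False
    then have "m \<le> j" by simp
    then show ?thesis
    proof (induction j rule: dec_induct)
      case base
      have "real (Suc m) * \<bar>cesaro_eigvec \<mu> m\<bar> \<le> real (Suc m) * real (Suc m) ^ m"
        by (intro mult_left_mono small) auto
      then show ?case by simp
    next
      case (step j)
      have j: "\<mu> \<le> real (Suc j)" using assms step(1) by linarith
      \<comment> \<open>Monotonicity comes from \<mu> \<ge> 1 together with (j + 2) j \<le> (j +
        1)^2.\<close>
      have "real (Suc (Suc j)) * (1 - \<mu> / real (Suc j)) \<le> real (Suc (Suc j)) * (1 - 1 / real (Suc j))"
        using assms by (intro mult_left_mono diff_left_mono divide_right_mono) auto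
      also have "\<dots> \<le> real (Suc j)"
        by (simp add: field_simps)
      finally have "real (Suc (Suc j)) * (1 - \<mu> / real (Suc j)) * \<bar>cesaro_eigvec \<mu> j\<bar>
          \<le> real (Suc j) * \<bar>cesaro_eigvec \<mu> j\<bar>"
        by (rule mult_right_mono) simp
      moreover have "\<bar>1 - \<mu> / real (Suc j)\<bar> = 1 - \<mu> / real (Suc j)"
        using j by (simp add: field_simps)
      ultimately show ?case
        using step.IH by (simp add: cesaro_eigvec_Suc abs_mult mult.assoc del: of_nat_Suc)
    qed
  qed
qed

text \<open>A square-summable majorant that is uniform for \<mu> in [1, m]: it yields both the
  boundedness of the functionals and their continuity in \<mu>.\<close>

lemma cesaro_eigvec_bound':
  assumes "1 \<le> \<mu>" "\<mu> \<le> real m"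
  shows "\<bar>cesaro_eigvec \<mu> j\<bar> \<le> real (Suc m) ^ Suc m * (1 / real (Suc j))"
  using cesaro_eigvec_bound[OF assms, of j] by (simp add: field_simps del: of_nat_Suc)

lemma summable_const_div_Suc_power2: "summable (\<lambda>j. (K * (1 / real (Suc j)))\<^sup>2)"
proof -
  have "summable (\<lambda>j. 1 / (real j + 1)\<^sup>2)"
    using inverse_squares_sums by (auto simp: sums_iff add.commute)
  then have "summable (\<lambda>j. K\<^sup>2 * (1 / (real j + 1)\<^sup>2))"
    by (rule summable_mult)
  then show ?thesis
    by (simp add: power_divide add.commute)
qed

lemma cesaro_eigvec_square_summable:
  assumes "1 \<le> \<mu>"
  shows "summable (\<lambda>j. (norm (complex_of_real (cesaro_eigvec \<mu> j)))\<^sup>2)"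
proof -
  obtain m where "\<mu> \<le> real m" using real_arch_simple by blast
  then have "(\<bar>cesaro_eigvec \<mu> j\<bar>)\<^sup>2 \<le> (real (Suc m) ^ Suc m * (1 / real (Suc j)))\<^sup>2" for j
    by (intro power_mono cesaro_eigvec_bound' assms) auto
  then show ?thesis
    by (intro summable_comparison_test'[OF summable_const_div_Suc_power2, where N = 0]) auto
qed

text \<open>The functional \<open>L\<^sub>\<mu>\<close>. It is linear in \<open>f\<close>, as the
  weights are real and nothing is conjugated.\<close>

definition eigen_pairing :: "real \<Rightarrow> (complex \<Rightarrow> complex) \<Rightarrow> complex" where
  "eigen_pairing \<mu> f = (\<Sum>k. complex_of_real (cesaro_eigvec \<mu> k) * taylor_coeff f k)"

lemma eigen_pairing_summable:
  assumes "1 \<le> \<mu>" "f \<in> hardy_space"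
  shows "summable (\<lambda>k. complex_of_real (cesaro_eigvec \<mu> k) * taylor_coeff f k)"
  by (intro summable_mult_of_square_summable cesaro_eigvec_square_summable hardy_spaceD assms)

lemma eigen_pairing_add:
  assumes "1 \<le> \<mu>" "f \<in> hardy_space" "g \<in> hardy_space"
  shows "eigen_pairing \<mu> (\<lambda>z. f z + g z) = eigen_pairing \<mu> f + eigen_pairing \<mu> g"
  using assms
  by (simp add: eigen_pairing_def taylor_coeff_add distrib_left suminf_add eigen_pairing_summable)

lemma eigen_pairing_cmult:
  assumes "1 \<le> \<mu>" "f \<in> hardy_space"
  shows "eigen_pairing \<mu> (\<lambda>z. c * f z) = c * eigen_pairing \<mu> f"
  using assms
  by (simp add: eigen_pairing_def taylor_coeff_cmult mult.left_commute[of _ c] suminf_mult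
      eigen_pairing_summable)

lemma eigen_pairing_hardy_monom:
  "eigen_pairing \<mu> (hardy_monom j) = complex_of_real (cesaro_eigvec \<mu> j)"
proof -
  have "(\<lambda>k. complex_of_real (cesaro_eigvec \<mu> k) * taylor_coeff (hardy_monom j) k)
    sums complex_of_real (cesaro_eigvec \<mu> j)"
    using sums_single[of j "\<lambda>k. complex_of_real (cesaro_eigvec \<mu> k)"]
    by (simp add: taylor_coeff_hardy_monom if_distrib cong: if_cong)
  then show ?thesis by (simp add: eigen_pairing_def sums_iff)
qed

text \<open>At \<mu> = n + 1 the function (1 - z)^n is a polynomial, so the series is a finite sum
  of the kind that binomial inversion handles.\<close>

lemma eigen_pairing_of_nat:
  "eigen_pairing (real (Suc n)) f =
    (\<Sum>k\<le>n. (-1) ^ k * of_nat (n choose k) * taylor_coeff f k)"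
  unfolding eigen_pairing_def cesaro_eigvec_of_nat by (subst suminf_finite[of "{..n}"]) auto

text \<open>Each partial sum is continuous in \<mu>, and the Weierstrass test makes the convergence
  uniform on [1, m].\<close>

lemma continuous_on_eigen_pairing:
  assumes f: "f \<in> hardy_space"
  shows "continuous_on {1..real m} (\<lambda>\<mu>. eigen_pairing \<mu> f)"
proof -
  define B where "B j = real (Suc m) ^ Suc m * (1 / real (Suc j))" for j
  have "uniform_limit {1..real m}
      (\<lambda>N \<mu>. \<Sum>k<N. complex_of_real (cesaro_eigvec \<mu> k) * taylor_coeff f k)
      (\<lambda>\<mu>. eigen_pairing \<mu> f) sequentially"
    unfolding eigen_pairing_def
  proof (rule Weierstrass_m_test)
    have "summable (\<lambda>j. (B j)\<^sup>2)"
      unfolding B_def by (rule summable_const_div_Suc_power2)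
    \<comment> \<open>Both factors are square summable; the detour through the complex numbers
      matches the type of the product lemma.\<close>
    then have "summable (\<lambda>j. complex_of_real (B j) * complex_of_real (norm (taylor_coeff f j)))"
      by (intro summable_mult_of_square_summable) (simp_all add: hardy_spaceD(3)[OF f])
    then show "summable (\<lambda>j. B j * norm (taylor_coeff f j))"
      by (simp flip: of_real_mult add: summable_complex_of_real)
    show "norm (complex_of_real (cesaro_eigvec \<mu> k) * taylor_coeff f k)
        \<le> B k * norm (taylor_coeff f k)" if "\<mu> \<in> {1..real m}" for k \<mu>
      using that unfolding norm_mult norm_of_real B_def
      by (intro mult_right_mono cesaro_eigvec_bound') auto
  qed
  then show ?thesis
    by (rule uniform_limit_theorem[rotated])
      (auto intro!: always_eventually continuous_intros continuous_on_cesaro_eigvec)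
qed

text \<open>Abel summation: the eigenvalue equation truncated at N, with a boundary term. That term
  tends to 0 when the averages lie in the Hardy space, and it is exactly 0 for \<mu> = N = n +
  1.\<close>

lemma cesaro_eigvec_sum_by_parts:
  fixes a :: "nat \<Rightarrow> complex"
  assumes "\<mu> \<noteq> 0"
  shows "(\<Sum>i<N. complex_of_real (cesaro_eigvec \<mu> i) * ((\<Sum>j\<le>i. a j) / of_nat (Suc i))) =
    ((\<Sum>i<N. complex_of_real (cesaro_eigvec \<mu> i) * a i)
      - complex_of_real (cesaro_eigvec \<mu> N) * (\<Sum>j<N. a j)) / of_real \<mu>"
proof (induction N)
  case (Suc N)
  define s where "s = (\<Sum>j<N. a j)"
  have s: "(\<Sum>j\<le>N. a j) = s + a N" "(\<Sum>j<Suc N. a j) = s + a N"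
    by (simp_all add: s_def lessThan_Suc_atMost[symmetric])
  have eq: "complex_of_real (cesaro_eigvec \<mu> (Suc N)) =
      complex_of_real (cesaro_eigvec \<mu> N) - of_real \<mu> * complex_of_real (cesaro_eigvec \<mu> N) / of_nat (Suc N)"
    by (simp add: cesaro_eigvec_Suc algebra_simps)
  show ?case
    unfolding sum.lessThan_Suc[of "\<lambda>i. complex_of_real (cesaro_eigvec \<mu> i) * _ i"] Suc s eq
    using assms by (simp add: s_def[symmetric] diff_divide_distrib add_divide_distrib
        distrib_left distrib_right left_diff_distrib right_diff_distrib del: of_nat_Suc)
qed simp

text \<open>The limit of the summation by parts. The image is an arbitrary \<open>h\<close> with the
  averaged coefficients, so that \<open>A (A f)\<close> can be used for it.\<close>

lemma eigen_pairing_cesaro: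
  assumes \<mu>: "1 \<le> \<mu>" and f: "f \<in> hardy_space" and h: "h \<in> hardy_space"
    and coeff: "\<And>n. taylor_coeff h n = (\<Sum>j\<le>n. taylor_coeff f j) / of_nat (Suc n)"
  shows "eigen_pairing \<mu> h = eigen_pairing \<mu> f / of_real \<mu>"
proof -
  define E where "E n = complex_of_real (cesaro_eigvec \<mu> n)" for n
  obtain m where m: "\<mu> \<le> real m" using real_arch_simple by blast
  have "(\<lambda>n. (norm (taylor_coeff h n))\<^sup>2) \<longlonglongrightarrow> 0"
    by (rule summable_LIMSEQ_zero[OF hardy_spaceD(3)[OF h]])
  then have "(\<lambda>n. real (Suc m) ^ Suc m * norm (taylor_coeff h n)) \<longlonglongrightarrow> real (Suc m) ^ Suc m * 0"
    by (intro tendsto_mult tendsto_const) (simp add: tendsto_norm_zero_iff)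
  \<comment> \<open>The boundary term at n + 1: the partial sum is n + 1 times the n-th coefficient
    of \<open>h\<close>, and the factor n + 1 is absorbed by the decay of the eigenvector.\<close>
  then have "(\<lambda>n. E (Suc n) * (\<Sum>j<Suc n. taylor_coeff f j)) \<longlonglongrightarrow> 0"
  proof (rule Lim_null_comparison[rotated, OF tendsto_eq_rhs], goal_cases)
    case 2
    have "norm (E (Suc n) * (\<Sum>j<Suc n. taylor_coeff f j))
        \<le> real (Suc m) ^ Suc m * norm (taylor_coeff h n)" for n
    proof -
      have "(\<Sum>j<Suc n. taylor_coeff f j) = of_nat (Suc n) * taylor_coeff h n"
        by (simp add: coeff lessThan_Suc_atMost del: of_nat_Suc)
      then have "norm (E (Suc n) * (\<Sum>j<Suc n. taylor_coeff f j)) =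
          real (Suc n) * \<bar>cesaro_eigvec \<mu> (Suc n)\<bar> * norm (taylor_coeff h n)"
        by (simp add: E_def norm_mult del: of_nat_Suc)
      also have "\<dots> \<le> real (Suc m) ^ Suc m * norm (taylor_coeff h n)"
      proof (rule mult_right_mono)
        have "real (Suc n) * \<bar>cesaro_eigvec \<mu> (Suc n)\<bar>
            \<le> real (Suc (Suc n)) * \<bar>cesaro_eigvec \<mu> (Suc n)\<bar>"
          by (rule mult_right_mono) auto
        also have "\<dots> \<le> real (Suc m) ^ Suc m"
          by (rule cesaro_eigvec_bound[OF \<mu> m])
        finally show "real (Suc n) * \<bar>cesaro_eigvec \<mu> (Suc n)\<bar> \<le> real (Suc m) ^ Suc m" .
      qed simp
      finally show ?thesis .
    qed
    then show ?case by simp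
  qed simp
  then have lim: "(\<lambda>n. E n * (\<Sum>j<n. taylor_coeff f j)) \<longlonglongrightarrow> 0"
    by (rule LIMSEQ_imp_Suc)
  have "(\<lambda>N. ((\<Sum>i<N. E i * taylor_coeff f i) - E N * (\<Sum>j<N. taylor_coeff f j)) / of_real \<mu>)
      \<longlonglongrightarrow> (eigen_pairing \<mu> f - 0) / of_real \<mu>"
    unfolding eigen_pairing_def E_def[symmetric]
    by (intro tendsto_intros lim summable_LIMSEQ) (use \<mu> eigen_pairing_summable[OF \<mu> f] in \<open>auto simp: E_def\<close>)
  moreover have "(\<lambda>N. \<Sum>i<N. E i * taylor_coeff h i) \<longlonglongrightarrow> eigen_pairing \<mu> h"
    unfolding eigen_pairing_def E_def by (intro summable_LIMSEQ eigen_pairing_summable \<mu> h)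
  moreover have "(\<Sum>i<N. E i * taylor_coeff h i) =
      ((\<Sum>i<N. E i * taylor_coeff f i) - E N * (\<Sum>j<N. taylor_coeff f j)) / of_real \<mu>" for N
    unfolding coeff E_def by (rule cesaro_eigvec_sum_by_parts) (use \<mu> in auto)
  ultimately show ?thesis
    by (simp add: LIMSEQ_unique)
qed

subsection \<open>Binomial inversion\<close>

text \<open>The matrix P with entries (-1)^k (n choose k) is an involution: (i choose n)(n choose k)
  = (i choose k)(i - k choose n - k) leaves an alternating row sum, which vanishes unless k =
  i.\<close>

lemma binomial_orthogonality:
  "(\<Sum>n\<le>i. (-1) ^ n * of_nat (i choose n) * ((-1) ^ k * of_nat (n choose k))) =
    (if k = i then 1 else 0 :: 'a::comm_ring_1)"
proof (cases "k \<le> i")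
  case True
  have "(\<Sum>n\<le>i. (-1) ^ n * of_nat (i choose n) * ((-1) ^ k * of_nat (n choose k))) =
      (\<Sum>n=k..i. (-1) ^ n * of_nat (i choose n) * ((-1) ^ k * of_nat (n choose k)) :: 'a)"
    by (rule sum.mono_neutral_right) (auto simp: not_le binomial_eq_0)
  also have "\<dots> = (\<Sum>l\<le>i - k. (-1) ^ l * of_nat ((i - k) choose l)) * of_nat (i choose k)"
    unfolding sum_distrib_right
  proof (rule sum.reindex_bij_witness[of _ "\<lambda>l. l + k" "\<lambda>n. n - k"], goal_cases)
    case (5 n)
    then have "of_nat (i choose n) * of_nat (n choose k) =
        (of_nat (i choose k) * of_nat ((i - k) choose (n - k)) :: 'a)"
      using choose_mult[of k n i] by (metis of_nat_mult atLeastAtMost_iff)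
    moreover have "(-1) ^ n * (-1) ^ k = ((-1) ^ (n - k) :: 'a)"
      using 5 by (simp add: minus_one_power_iff)
    moreover have "(-1) ^ n * of_nat (i choose n) * ((-1) ^ k * of_nat (n choose k)) =
        (-1) ^ n * (-1) ^ k * (of_nat (i choose n) * of_nat (n choose k) :: 'a)"
      by (simp only: mult_ac)
    ultimately show ?case
      by (simp only: mult_ac)
  qed (use True in auto)
  also have "\<dots> = (if k = i then 1 else 0)"
    using choose_alternating_sum[of "i - k", where ?'a = 'a] True by auto
  finally show ?thesis .
next
  case False
  then show ?thesis by (auto simp: binomial_eq_0 intro!: sum.neutral)
qed

lemma binomial_inversion:
  fixes a b :: "nat \<Rightarrow> 'a::comm_ring_1"
  assumes "\<And>n. (\<Sum>k\<le>n. (-1) ^ k * of_nat (n choose k) * a k) = b n"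
  shows "a i = (\<Sum>n\<le>i. (-1) ^ n * of_nat (i choose n) * b n)"
proof -
  have "(\<Sum>n\<le>i. (-1) ^ n * of_nat (i choose n) * b n) =
      (\<Sum>n\<le>i. (-1) ^ n * of_nat (i choose n) * (\<Sum>k\<le>i. (-1) ^ k * of_nat (n choose k) * a k))"
  proof (intro sum.cong refl)
    fix n assume "n \<in> {..i}"
    then have "b n = (\<Sum>k\<le>i. (-1) ^ k * of_nat (n choose k) * a k)"
      \<comment> \<open>Padding the inner sum with zero terms up to i makes its range independent of
        n, so that the sums can be exchanged.\<close>
      unfolding assms[symmetric] by (intro sum.mono_neutral_left) (auto simp: not_le binomial_eq_0)
    then show "(-1) ^ n * of_nat (i choose n) * b n =
        (-1) ^ n * of_nat (i choose n) * (\<Sum>k\<le>i. (-1) ^ k * of_nat (n choose k) * a k)"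
      by simp
  qed
  also have "\<dots> = (\<Sum>k\<le>i. (\<Sum>n\<le>i. (-1) ^ n * of_nat (i choose n) * ((-1) ^ k * of_nat (n choose k))) * a k)"
    unfolding sum_distrib_left sum_distrib_right by (subst sum.swap) (simp add: mult.assoc)
  also have "\<dots> = (\<Sum>k\<le>i. if k = i then a k else 0)"
    unfolding binomial_orthogonality by (intro sum.cong) auto
  finally show ?thesis by simp
qed

text \<open>The entries are those of P D P, with P the signed binomial involution and D diagonal
  with entries 1 / sqrt (n + 1); the substitution n = l + j produces the closed form.\<close>

lemma cesaro_sqrt_entry_eq:
  "complex_of_real (cesaro_sqrt_entry i j) =
    (\<Sum>n\<le>i. (-1) ^ n * of_nat (i choose n) *
      (of_real (1 / sqrt (real (Suc n))) * ((-1) ^ j * of_nat (n choose j))))"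
proof -
  have "cesaro_sqrt_entry i j =
    (\<Sum>n\<le>i. (-1) ^ n * real (i choose n) * (1 / sqrt (real (Suc n)) * ((-1) ^ j * real (n choose j))))"
  proof (cases "j \<le> i")
    case True
    have "(\<Sum>n\<le>i. (-1) ^ n * real (i choose n) * (1 / sqrt (real (Suc n)) * ((-1) ^ j * real (n choose j))))
      = (\<Sum>n=j..i. (-1) ^ n * real (i choose n) * (1 / sqrt (real (Suc n)) * ((-1) ^ j * real (n choose j))))"
      by (rule sum.mono_neutral_right) (auto simp: not_le binomial_eq_0)
    also have "\<dots> = (\<Sum>l=0..i - j. real (i choose j) *
        ((-1) ^ l * (1 / sqrt (real (l + j + 1))) * real ((i - j) choose l)))"
    proof (rule sum.reindex_bij_witness[of _ "\<lambda>l. l + j" "\<lambda>n. n - j"], goal_cases)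
      case (5 n)
      then have "real (i choose n) * real (n choose j) = real (i choose j) * real ((i - j) choose (n - j))"
        using choose_mult[of j n i] by (metis of_nat_mult atLeastAtMost_iff)
      moreover have "(-1) ^ n * (-1) ^ j = ((-1) ^ (n - j) :: real)"
        using 5 by (simp add: minus_one_power_iff)
      moreover have "n - j + j + 1 = Suc n" using 5 by simp
      moreover have "(-1) ^ n * real (i choose n) *
            (1 / sqrt (real (Suc n)) * ((-1) ^ j * real (n choose j))) =
          (-1) ^ n * (-1) ^ j * (real (i choose n) * real (n choose j)) * (1 / sqrt (real (Suc n)))"
        by (simp only: mult_ac)
      ultimately show ?case
        by (simp only: mult_ac)
    qed (use True in auto)
    finally show ?thesis
      using True by (simp add: cesaro_sqrt_entry_def sum_distrib_left)
  qed (auto simp: cesaro_sqrt_entry_def binomial_eq_0 intro!: sum.neutral)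
  then show ?thesis by simp
qed

text \<open>The relation P M = D P for M = P D P, since P is its own inverse.\<close>

lemma sum_binomial_cesaro_sqrt_entry:
  "(\<Sum>k\<le>n. (-1) ^ k * of_nat (n choose k) * complex_of_real (cesaro_sqrt_entry k j)) =
    of_real (1 / sqrt (real (Suc n))) * ((-1) ^ j * of_nat (n choose j))"
  by (rule binomial_inversion[symmetric]) (rule cesaro_sqrt_entry_eq[symmetric])

subsection \<open>Square roots of the Cesaro operator\<close>

text \<open>The values of the functional \<open>f \<mapsto> L\<^sub>\<mu> (A f)\<close> on the
  monomials satisfy the recursion of the eigenvector, hence are multiples of it; the factor is the
  value at \<open>hardy_monom 0\<close>, where the eigenvector is 1.\<close>

lemma cesaro_square_root_eigen:
  assumes A: "hardy_bounded_operator A"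
    and sq: "\<And>f. f \<in> hardy_space \<Longrightarrow> A (A f) = cesaro f" and \<mu>: "1 \<le> \<mu>"
  defines "\<phi> \<equiv> eigen_pairing \<mu> (A (hardy_monom 0))"
  shows "f \<in> hardy_space \<Longrightarrow> eigen_pairing \<mu> (A f) = \<phi> * eigen_pairing \<mu> f"
    and "\<phi>\<^sup>2 = 1 / of_real \<mu>"
proof -
  note in_hs [simp] = hardy_bounded_operatorD(1)[OF A] hardy_monom_in_hardy_space
    hardy_space_add hardy_space_cmult
  have coeff: "taylor_coeff (A (A f)) n = (\<Sum>j\<le>n. taylor_coeff f j) / of_nat (Suc n)"
    if "f \<in> hardy_space" for f n
    using taylor_coeff_eqI[OF cesaro_sums[OF hardy_spaceD(1)[OF that]]] sq[OF that] by simp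
  have pairing_sq: "eigen_pairing \<mu> (A (A f)) = eigen_pairing \<mu> f / of_real \<mu>"
    if "f \<in> hardy_space" for f
    using that by (intro eigen_pairing_cesaro \<mu> coeff) auto
  have t: "eigen_pairing \<mu> (A (hardy_monom j)) = \<phi> * of_real (cesaro_eigvec \<mu> j)" for j
  proof (induction j)
    case (Suc j)
    let ?e = "hardy_monom j" and ?e' = "hardy_monom (Suc j)"
    define c :: complex where "c = 1 / of_nat (Suc j)"
    \<comment> \<open>The images of neighbouring monomials under \<open>cesaro\<close> differ only
      in the coefficient of index j, which is 1 / (j + 1).\<close>
    have "A (A ?e) = (\<lambda>z. A (A ?e') z + c * ?e z)"
    proof (rule hardy_space_coeff_eqI)
      have "taylor_coeff (\<lambda>z. A (A ?e') z + c * ?e z) n =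
          taylor_coeff (A (A ?e')) n + c * taylor_coeff ?e n" for n
        by (simp add: taylor_coeff_add taylor_coeff_cmult)
      then show "taylor_coeff (A (A ?e)) = taylor_coeff (\<lambda>z. A (A ?e') z + c * ?e z)"
        by (auto simp: fun_eq_iff coeff taylor_coeff_hardy_monom c_def)
    qed auto
    \<comment> \<open>The cube of \<open>A\<close> encodes commutation: the identity is obtained as
      \<open>A\<close> applied to the Cesaro images, and \<open>pairing_sq\<close> then reads it as
      the Cesaro operator applied to the images under \<open>A\<close>.\<close>
    then have "A (A (A ?e)) = A (\<lambda>z. A (A ?e') z + c * ?e z)"
      by simp
    also have "\<dots> = (\<lambda>z. A (A (A ?e')) z + c * A ?e z)"
      by (simp add: hardy_bounded_operatorD[OF A])
    finally have "eigen_pairing \<mu> (A (A (A ?e))) =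
        eigen_pairing \<mu> (A (A (A ?e'))) + c * eigen_pairing \<mu> (A ?e)"
      using \<mu> by (simp add: eigen_pairing_add eigen_pairing_cmult)
    then have "eigen_pairing \<mu> (A ?e) / of_real \<mu> =
        eigen_pairing \<mu> (A ?e') / of_real \<mu> + c * eigen_pairing \<mu> (A ?e)"
      by (simp add: pairing_sq)
    then have "eigen_pairing \<mu> (A ?e') = (1 - of_real \<mu> * c) * eigen_pairing \<mu> (A ?e)"
      using \<mu> by (simp add: field_simps)
    then show ?case
      by (simp add: Suc cesaro_eigvec_Suc c_def)
  qed (simp add: \<phi>_def)
  show *: "eigen_pairing \<mu> (A f) = \<phi> * eigen_pairing \<mu> f" if f: "f \<in> hardy_space" for f
  proof -
    \<comment> \<open>Boundedness of \<open>A\<close> extends the identity from monomials to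
      \<open>f\<close>.\<close>
    have "(\<lambda>j. taylor_coeff f j * (\<phi> * of_real (cesaro_eigvec \<mu> j))) sums eigen_pairing \<mu> (A f)"
      using hardy_functional_sums[OF A cesaro_eigvec_square_summable[OF \<mu>] f]
      by (simp add: eigen_pairing_def[symmetric] t)
    moreover have "(\<lambda>j. \<phi> * (of_real (cesaro_eigvec \<mu> j) * taylor_coeff f j))
        sums (\<phi> * eigen_pairing \<mu> f)"
      unfolding eigen_pairing_def by (intro sums_mult summable_sums eigen_pairing_summable \<mu> f)
    ultimately show ?thesis
      by (simp add: mult_ac sums_iff)
  qed
  have "\<phi> * \<phi> = eigen_pairing \<mu> (A (A (hardy_monom 0)))"
    by (subst *) (simp_all add: \<phi>_def)
  also have "\<dots> = 1 / of_real \<mu>"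
    by (simp add: pairing_sq eigen_pairing_hardy_monom)
  finally show "\<phi>\<^sup>2 = 1 / of_real \<mu>"
    by (simp add: power2_eq_square)
qed

text \<open>The eigenvalue times sqrt \<mu> is continuous on every interval [1, m] and takes only
  the values 1 and -1, so by connectedness it keeps its value at \<mu> = 1.\<close>

lemma cesaro_square_root_sign:
  assumes A: "hardy_bounded_operator A"
    and sq: "\<And>f. f \<in> hardy_space \<Longrightarrow> A (A f) = cesaro f"
  obtains s :: complex where "s = 1 \<or> s = -1"
    "\<And>\<mu>. 1 \<le> \<mu> \<Longrightarrow> eigen_pairing \<mu> (A (hardy_monom 0)) = s / of_real (sqrt \<mu>)"
proof -
  define h where "h \<mu> = eigen_pairing \<mu> (A (hardy_monom 0)) * of_real (sqrt \<mu>)" for \<mu>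
  have h_sq: "h \<mu> = 1 \<or> h \<mu> = -1" if "1 \<le> \<mu>" for \<mu>
  proof -
    have "(h \<mu>)\<^sup>2 = 1"
      using cesaro_square_root_eigen(2)[OF A sq that] that
      by (simp add: h_def power_mult_distrib flip: of_real_power)
    then show ?thesis by (simp add: power2_eq_1_iff)
  qed
  have h_const: "h \<mu> = h 1" if "1 \<le> \<mu>" for \<mu>
  proof -
    obtain m where m: "\<mu> \<le> real m" using real_arch_simple by blast
    have "continuous_on {1..real m} h"
      unfolding h_def
      by (intro continuous_intros continuous_on_eigen_pairing hardy_bounded_operatorD(1)[OF A]
          hardy_monom_in_hardy_space)
    moreover have "finite (h ` {1..real m})"
      by (rule finite_subset[of _ "{1, -1}"]) (use h_sq in fastforce)+
    ultimately have "h constant_on {1..real m}"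
      by (intro continuous_finite_range_constant) auto
    then show ?thesis
      using m that unfolding constant_on_def by fastforce
  qed
  show thesis
  proof (rule that[of "h 1"])
    fix \<mu> :: real assume "1 \<le> \<mu>"
    then show "eigen_pairing \<mu> (A (hardy_monom 0)) = h 1 / of_real (sqrt \<mu>)"
      using h_const[of \<mu>] by (simp add: h_def field_simps)
  qed (use h_sq in auto)
qed

text \<open>The eigenvalue identities at \<mu> = n + 1 say P M = s D P for the matrix M of
  \<open>A\<close>; inverting P gives M = s P D P.\<close>

lemma cesaro_square_root_matrix:
  assumes A: "hardy_bounded_operator A"
    and sq: "\<And>f. f \<in> hardy_space \<Longrightarrow> A (A f) = cesaro f"
  obtains s where "s = 1 \<or> s = -1"
    "\<And>i j. hardy_matrix A i j = s * complex_of_real (cesaro_sqrt_entry i j)"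
proof -
  obtain s where s: "s = 1 \<or> s = -1"
    "\<And>\<mu>. 1 \<le> \<mu> \<Longrightarrow> eigen_pairing \<mu> (A (hardy_monom 0)) = s / of_real (sqrt \<mu>)"
    using cesaro_square_root_sign[OF A sq] by blast
  have "hardy_matrix A i j = s * complex_of_real (cesaro_sqrt_entry i j)" for i j
  proof -
    have "(\<Sum>k\<le>n. (-1) ^ k * of_nat (n choose k) * taylor_coeff (A (hardy_monom j)) k) =
        s * (of_real (1 / sqrt (real (Suc n))) * ((-1) ^ j * of_nat (n choose j)))" for n
    proof -
      have "1 \<le> real (Suc n)" by simp
      from cesaro_square_root_eigen(1)[OF A sq this hardy_monom_in_hardy_space, of j] s(2)[OF this]
      show ?thesis
        unfolding eigen_pairing_hardy_monom cesaro_eigvec_of_nat by (simp add: eigen_pairing_of_nat del: of_nat_Suc)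
    qed
    from binomial_inversion[OF this, of i] show ?thesis
      unfolding hardy_matrix_eq cesaro_sqrt_entry_eq sum_distrib_left
      by (simp add: mult.left_commute[of s] del: of_nat_Suc of_real_divide)
  qed
  with s(1) show thesis by (rule that)
qed

text \<open>From P M = s D P, applying \<open>A\<close> multiplies the functional at \<mu> = n + 1
  by s / sqrt (n + 1). Applying it twice gives 1 / (n + 1), as for the Cesaro operator.\<close>

lemma cesaro_square_root_of_matrix:
  assumes A: "hardy_bounded_operator A" and f: "f \<in> hardy_space" and s: "s = 1 \<or> s = -1"
    and M: "\<And>i j. hardy_matrix A i j = s * complex_of_real (cesaro_sqrt_entry i j)"
  shows "A (A f) = cesaro f"
proof (rule hardy_space_eqI)
  note [simp] = hardy_bounded_operatorD(1)[OF A]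
  have eigen: "eigen_pairing (real (Suc n)) (A g) =
      s / of_real (sqrt (real (Suc n))) * eigen_pairing (real (Suc n)) g"
    if g: "g \<in> hardy_space" for g n
  proof -
    have n: "1 \<le> real (Suc n)" by simp
    have "eigen_pairing (real (Suc n)) (A (hardy_monom j)) =
        s / of_real (sqrt (real (Suc n))) * of_real (cesaro_eigvec (real (Suc n)) j)" for j
    proof -
      have "eigen_pairing (real (Suc n)) (A (hardy_monom j)) =
          s * (\<Sum>k\<le>n. (-1) ^ k * of_nat (n choose k) * complex_of_real (cesaro_sqrt_entry k j))"
        unfolding eigen_pairing_of_nat hardy_matrix_eq[symmetric] M
        by (simp add: sum_distrib_left mult.left_commute[of s])
      then show ?thesis
        unfolding sum_binomial_cesaro_sqrt_entry cesaro_eigvec_of_nat by simp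
    qed
    then have "(\<lambda>j. taylor_coeff g j *
        (s / of_real (sqrt (real (Suc n))) * of_real (cesaro_eigvec (real (Suc n)) j)))
        sums eigen_pairing (real (Suc n)) (A g)"
      using hardy_functional_sums[OF A cesaro_eigvec_square_summable[OF n] g]
      by (simp add: eigen_pairing_def[symmetric] del: of_nat_Suc)
    moreover have "(\<lambda>j. s / of_real (sqrt (real (Suc n))) *
        (of_real (cesaro_eigvec (real (Suc n)) j) * taylor_coeff g j))
        sums (s / of_real (sqrt (real (Suc n))) * eigen_pairing (real (Suc n)) g)"
      unfolding eigen_pairing_def by (intro sums_mult summable_sums eigen_pairing_summable n g)
    ultimately show ?thesis
      by (simp add: mult_ac sums_iff del: of_nat_Suc)
  qed
  define c where "c n = (\<Sum>j\<le>n. taylor_coeff f j) / of_nat (Suc n)" for n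
  have "(\<Sum>k\<le>n. (-1) ^ k * of_nat (n choose k) * taylor_coeff (A (A f)) k) =
      (\<Sum>k\<le>n. (-1) ^ k * of_nat (n choose k) * c k)" for n
  proof -
    have root: "complex_of_real (sqrt (real (Suc n))) * of_real (sqrt (real (Suc n))) = of_nat (Suc n)"
      by (simp del: of_nat_Suc flip: of_real_mult)
    have "(\<Sum>k\<le>n. (-1) ^ k * of_nat (n choose k) * taylor_coeff (A (A f)) k) =
        eigen_pairing (real (Suc n)) f / of_nat (Suc n)"
      using s unfolding eigen_pairing_of_nat[symmetric] eigen[OF f]
      by (auto simp: eigen f root simp del: of_nat_Suc)
    also have "\<dots> = (\<Sum>k\<le>n. (-1) ^ k * of_nat (n choose k) * c k)"
      using cesaro_eigvec_sum_by_parts[of "real (Suc n)" "taylor_coeff f" "Suc n"]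
      unfolding cesaro_eigvec_of_nat eigen_pairing_of_nat
      by (simp add: c_def lessThan_Suc_atMost binomial_eq_0 del: of_nat_Suc sum.lessThan_Suc)
    finally show ?thesis .
  qed
  then have "taylor_coeff (A (A f)) i = c i" for i
    \<comment> \<open>Sequences with equal signed binomial transforms are equal: both are recovered
      by the same inversion formula.\<close>
    by (rule trans[OF binomial_inversion binomial_inversion[OF refl, symmetric]])
  then have "taylor_coeff (A (A f)) = c"
    by (rule ext)
  then show "(\<lambda>n. taylor_coeff (A (A f)) n * z ^ n) sums cesaro f z" if "z \<in> ball 0 1" for z
    using cesaro_sums[OF hardy_spaceD(1)[OF f] that] by (simp add: c_def)
qed (use hardy_bounded_operatorD(1)[OF A] f in \<open>auto simp: cesaro_def\<close>)

theorem theorem7p4: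
  fixes A :: "(complex \<Rightarrow> complex) \<Rightarrow> complex \<Rightarrow> complex"
  assumes "hardy_bounded_operator A"
  shows "(\<forall>f\<in>hardy_space. A (A f) = cesaro f) \<longleftrightarrow>
    ((\<forall>i j. hardy_matrix A i j = complex_of_real (cesaro_sqrt_entry i j)) \<or>
     (\<forall>i j. hardy_matrix A i j = - complex_of_real (cesaro_sqrt_entry i j)))"
proof
  assume "\<forall>f\<in>hardy_space. A (A f) = cesaro f"
  then obtain s where "s = 1 \<or> s = -1"
    "\<And>i j. hardy_matrix A i j = s * complex_of_real (cesaro_sqrt_entry i j)"
    using cesaro_square_root_matrix[OF assms] by metis
  then show "(\<forall>i j. hardy_matrix A i j = complex_of_real (cesaro_sqrt_entry i j)) \<or>
     (\<forall>i j. hardy_matrix A i j = - complex_of_real (cesaro_sqrt_entry i j))"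
    by auto
next
  assume "(\<forall>i j. hardy_matrix A i j = complex_of_real (cesaro_sqrt_entry i j)) \<or>
     (\<forall>i j. hardy_matrix A i j = - complex_of_real (cesaro_sqrt_entry i j))"
  then obtain s where "s = 1 \<or> s = -1"
    "\<And>i j. hardy_matrix A i j = s * complex_of_real (cesaro_sqrt_entry i j)"
    by (metis mult_1 mult_minus1)
  then show "\<forall>f\<in>hardy_space. A (A f) = cesaro f"
    using cesaro_square_root_of_matrix[OF assms] by blast
qed

end
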